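(* For every $n\ge 1$, the polynomial in $q$ $$\left(\sum_{k=0}^n(-q^2)^{n-k}[k]_q!\,S[n,k]\right)-1$$ is palindromic ignoring signs, has the same number of positive and negative coefficients, and the lower-degree half of its nonzero coefficients are positive and the remaining nonzero coefficients are negative.
   Context: $[k]_q=1+q+\cdots+q^{k-1}$, $[k]_q!=[k]_q[k-1]_q\cdots[1]_q$, $[0]_q!=1$. $S[n,k]$ are the $q$-Stirling numbers of the second kind, polynomials in $q$ defined by $S[0,k]=\delta_{0,k}$, $S[n,0]=\delta_{n,0}$ and $S[n,k]=S[n-1,k-1]+[k]_qS[n-1,k]$ for $1\le k\le n$ (with $S[n,k]=0$ for $k>n$). "Palindromic ignoring signs" means that the sequence of absolute values of the coefficients, read from the lowest-degree nonzero term to the highest-degree nonzero term, is a palindrome (the zero polynomial, which occurs for $n=1$, satisfies all conditions vacuously). *)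

theory Defs
  imports Complex_Main "HOL-Computational_Algebra.Polynomial"
begin

abbreviation q :: "int poly" where
  "q \<equiv> [:0, 1:]"

definition q_int :: "nat \<Rightarrow> int poly" where
  "q_int k = (\<Sum>i<k. q ^ i)"

definition q_fact :: "nat \<Rightarrow> int poly" where
  "q_fact k = (\<Prod>i = 1..k. q_int i)"

fun q_stirling :: "nat \<Rightarrow> nat \<Rightarrow> int poly" where
  "q_stirling 0 0 = 1"
| "q_stirling 0 (Suc k) = 0"
| "q_stirling (Suc n) 0 = 0"
| "q_stirling (Suc n) (Suc k) = q_stirling n k + q_int (Suc k) * q_stirling n (Suc k)"

text \<open>The recurrence is imposed without the restriction \<open>k \<le> n\<close>; the convention
  for \<open>k > n\<close> then follows.\<close>

lemma q_stirling_eq_0: "n < k \<Longrightarrow> q_stirling n k = 0"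
  by (induction n k rule: q_stirling.induct) auto

text \<open>The list \<open>coeffs p\<close> runs from degree 0 to the degree of \<open>p\<close>, so its last entry is
  nonzero and only low-degree zeros have to be removed. Zeros between the lowest and the highest
  nonzero term are kept.\<close>

definition palindromic_ignoring_signs :: "int poly \<Rightarrow> bool" where
  "palindromic_ignoring_signs p \<longleftrightarrow>
    (let cs = map abs (dropWhile (\<lambda>c. c = 0) (coeffs p)) in rev cs = cs)"

definition as_many_positive_as_negative :: "int poly \<Rightarrow> bool" where
  "as_many_positive_as_negative p \<longleftrightarrow> card {i. coeff p i > 0} = card {i. coeff p i < 0}"

definition nonzero_coeffs :: "int poly \<Rightarrow> int list" where
  "nonzero_coeffs p = filter (\<lambda>c. c \<noteq> 0) (coeffs p)"

definition lower_half_positive_rest_negative :: "int poly \<Rightarrow> bool" where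
  "lower_half_positive_rest_negative p \<longleftrightarrow>
    (let cs = nonzero_coeffs p; h = length cs div 2
     in (\<forall>c \<in> set (take h cs). c > 0) \<and> (\<forall>c \<in> set (drop h cs). c < 0))"

end

theory Submission
  imports Defs
begin

text \<open>
  The sum has the closed form \<open>(1 - q) (1 + q)\<^sup>n + q ^ (n + 1)\<close>. Put
  \<open>a n k = x ^ (n - k) [k]! S[n,k]\<close>. The Stirling recurrence turns into
  \<open>a (n + 1) k = [k] (a n (k - 1) + x a n k)\<close>, so that summing \<open>a (n + 1)\<close> against a weight \<open>w\<close> is
  the same as summing \<open>a n\<close> against the weight \<open>k \<mapsto> [k+1] w (k+1) + x [k] w k\<close>
  (\<open>sum_q_stirling_Suc\<close>). For \<open>x = - q\<^sup>2\<close> this operator on weights has the eigenvector \<open>q ^ k\<close> with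
  eigenvalue \<open>q\<close> and the eigenvector \<open>1 - q ^ (k + 1)\<close> with eigenvalue \<open>1 + q\<close>. The constant weight 1
  that occurs in the theorem is \<open>(1 - q ^ (k + 1)) + q \<cdot> q ^ k\<close>, which gives the closed form
  (\<open>alternating_q_stirling_sum\<close>).

  Hence the polynomial of the theorem is \<open>(1 - q) (1 + q)\<^sup>n\<close> without its two extreme terms \<open>1\<close> and
  \<open>- q ^ (n + 1)\<close>. Its remaining coefficients are the ballot numbers \<open>C(n,i) - C(n,i-1)\<close>. They are
  antisymmetric under \<open>i \<mapsto> n + 1 - i\<close>, because binomial coefficients are symmetric, and
  nonnegative for \<open>i \<le> n / 2\<close>, because binomial coefficients increase up to the middle. Antisymmetry
  yields the palindrome and the equal number of signs; together with the sign on the lower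
  half it yields the sign pattern.
\<close>

section \<open>Evaluating the alternating sum\<close>

lemma q_int_Suc: "q_int (Suc k) = 1 + q * q_int k"
  unfolding q_int_def by (subst sum.lessThan_Suc_shift) (simp add: sum_distrib_left)

lemma q_int_geometric: "(1 - q) * q_int k = 1 - q ^ k"
  unfolding q_int_def by (rule one_diff_power_eq[symmetric])

lemma q_fact_Suc: "q_fact (Suc k) = q_fact k * q_int (Suc k)"
  unfolding q_fact_def by (simp add: atLeastAtMostSuc_conv)

text \<open>
  One step of the Stirling recurrence, moved from the coefficients to the weight \<open>w\<close> by
  summation by parts: each \<open>k\<close> feeds \<open>k + 1\<close> through \<open>S[n,k]\<close> and itself through \<open>[k] S[n,k]\<close>.
\<close>

lemma sum_q_stirling_Suc:
  fixes x :: "int poly" and w :: "nat \<Rightarrow> int poly"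
  shows "(\<Sum>k\<le>Suc n. x ^ (Suc n - k) * q_fact k * q_stirling (Suc n) k * w k) =
    (\<Sum>k\<le>n. x ^ (n - k) * q_fact k * q_stirling n k *
      (q_int (Suc k) * w (Suc k) + x * q_int k * w k))"
proof -
  define u where "u k = x ^ (Suc n - k) * q_fact k * q_stirling n k * q_int k * w k" for k
  have u_0: "u 0 = 0"
    by (simp add: u_def q_int_def)
  have "(\<Sum>k\<le>Suc n. x ^ (Suc n - k) * q_fact k * q_stirling (Suc n) k * w k) =
      (\<Sum>k\<le>n. x ^ (n - k) * q_fact (Suc k) * q_stirling (Suc n) (Suc k) * w (Suc k))"
    by (subst sum.atMost_Suc_shift) simp
  also have "\<dots> = (\<Sum>k\<le>n. x ^ (n - k) * q_fact k * q_stirling n k *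
      (q_int (Suc k) * w (Suc k))) + (\<Sum>k\<le>n. u (Suc k))"
    by (simp add: sum.distrib[symmetric] u_def q_fact_Suc algebra_simps)
  also have "(\<Sum>k\<le>n. u (Suc k)) = (\<Sum>k\<le>Suc n. u k)"
    by (subst sum.atMost_Suc_shift) (simp add: u_0)
  also have "\<dots> = (\<Sum>k\<le>n. u k)"
    by (simp add: u_def q_stirling_eq_0)
  also have "\<dots> = (\<Sum>k\<le>n. x ^ (n - k) * q_fact k * q_stirling n k * (x * q_int k * w k))"
    by (intro sum.cong refl) (simp add: u_def Suc_diff_le algebra_simps)
  finally show ?thesis
    by (simp add: sum.distrib[symmetric] distrib_left)
qed

lemma sum_q_stirling_eigenweight:
  fixes x c :: "int poly" and w :: "nat \<Rightarrow> int poly"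
  assumes eigen: "\<And>k. q_int (Suc k) * w (Suc k) + x * q_int k * w k = c * w k"
  shows "(\<Sum>k\<le>n. x ^ (n - k) * q_fact k * q_stirling n k * w k) = c ^ n * w 0"
proof (induction n)
  case 0
  show ?case by (simp add: q_fact_def)
next
  case (Suc n)
  have "(\<Sum>k\<le>Suc n. x ^ (Suc n - k) * q_fact k * q_stirling (Suc n) k * w k) =
      (\<Sum>k\<le>n. x ^ (n - k) * q_fact k * q_stirling n k * (c * w k))"
    unfolding sum_q_stirling_Suc eigen ..
  also have "\<dots> = c * (\<Sum>k\<le>n. x ^ (n - k) * q_fact k * q_stirling n k * w k)"
    unfolding sum_distrib_left by (intro sum.cong refl) (simp only: ac_simps)
  finally show ?case
    unfolding Suc.IH by (simp only: power_Suc mult.assoc)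
qed

text \<open>
  The value \<open>x = - q\<^sup>2\<close> is the one for which both \<open>q ^ k\<close> and \<open>1 - q ^ (k + 1)\<close> are eigenweights:
  \<open>q [k+1] - q\<^sup>2 [k] = q\<close> handles the first, and \<open>[k+1] - q\<^sup>2 [k] = 1 + q - q ^ (k + 1)\<close> the second.
\<close>

lemma alternating_q_stirling_sum:
  "(\<Sum>k\<le>n. (- (q ^ 2)) ^ (n - k) * q_fact k * q_stirling n k) = (1 - q) * (1 + q) ^ n + q ^ Suc n"
proof -
  \<comment> \<open>Naming \<open>q\<close> keeps the simplifier from multiplying out the literal polynomial.\<close>
  define y where "y = q"
  define a where "a k = (- (y ^ 2)) ^ (n - k) * q_fact k * q_stirling n k" for k
  have Suc_y: "q_int (Suc k) = 1 + y * q_int k" for k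
    unfolding y_def by (rule q_int_Suc)
  have geom: "y * q_int k = q_int k + y ^ k - 1" for k
    using q_int_geometric[of k] unfolding y_def[symmetric] by (simp add: algebra_simps)
  have *: "(\<Sum>k\<le>n. a k * y ^ k) = y ^ n * y ^ 0"
    unfolding a_def
    by (rule sum_q_stirling_eigenweight) (simp add: Suc_y power2_eq_square algebra_simps)
  have **: "(\<Sum>k\<le>n. a k * (1 - y ^ Suc k)) = (1 + y) ^ n * (1 - y ^ Suc 0)"
    unfolding a_def
  proof (rule sum_q_stirling_eigenweight)
    fix k
    have "q_int (Suc k) * (1 - y ^ Suc (Suc k)) + - (y\<^sup>2) * q_int k * (1 - y ^ Suc k) =
        1 + y * ((1 - y) * q_int k) - y ^ Suc (Suc k)"
      by (simp add: Suc_y power2_eq_square algebra_simps)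
    also have "(1 - y) * q_int k = 1 - y ^ k"
      by (simp add: geom algebra_simps)
    finally show "q_int (Suc k) * (1 - y ^ Suc (Suc k)) + - (y\<^sup>2) * q_int k * (1 - y ^ Suc k) =
        (1 + y) * (1 - y ^ Suc k)"
      by (simp add: algebra_simps)
  qed
  have "(\<Sum>k\<le>n. a k) = (\<Sum>k\<le>n. a k * (1 - y ^ Suc k)) + y * (\<Sum>k\<le>n. a k * y ^ k)"
    by (simp add: sum_distrib_left sum.distrib[symmetric] algebra_simps)
  then show ?thesis
    unfolding * ** by (simp add: a_def y_def[symmetric] mult.commute)
qed

section \<open>Polynomials with antisymmetric coefficients\<close>

text \<open>
  The lowest nonzero term \<open>a\<close> and the degree are mirror images of each other, so cutting off
  the zeros below \<open>a\<close> leaves a range of indices that the reflection maps to itself.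
\<close>

lemma palindromic_ignoring_signsI:
  fixes p :: "int poly"
  assumes deg: "degree p \<le> d"
    and sym: "\<And>i. i \<le> d \<Longrightarrow> \<bar>coeff p (d - i)\<bar> = \<bar>coeff p i\<bar>"
  shows "palindromic_ignoring_signs p"
proof (cases "p = 0")
  case True
  then show ?thesis by (simp add: palindromic_ignoring_signs_def)
next
  case False
  define a where "a = (LEAST i. coeff p i \<noteq> 0)"
  have lead: "coeff p (degree p) \<noteq> 0"
    using False by simp
  have a_nz: "coeff p a \<noteq> 0"
    unfolding a_def using lead by (rule LeastI)
  have below: "coeff p i = 0" if "i < a" for i
    using not_less_Least[of i "\<lambda>i. coeff p i \<noteq> 0"] that by (auto simp: a_def)
  have a_deg: "a \<le> degree p"
    unfolding a_def using lead by (rule Least_le)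
  have "coeff p (d - a) \<noteq> 0"
    using sym[of a] a_nz a_deg deg by simp
  then have "d - a \<le> degree p"
    by (rule le_degree)
  moreover have "coeff p (d - degree p) \<noteq> 0"
    using sym[of "degree p"] lead deg by (metis abs_eq_0)
  then have "a \<le> d - degree p"
    using below not_le by blast
  ultimately have degree_eq: "degree p = d - a" and "a \<le> d - a"
    using a_deg deg by linarith+
  let ?cs = "map (coeff p) [a..<Suc (d - a)]"
  have "[0..<Suc (d - a)] = [0..<a] @ [a..<Suc (d - a)]"
    using upt_add_eq_append[of 0 a "Suc (d - a) - a"] \<open>a \<le> d - a\<close>
    by (metis add_0 le_SucI le_add_diff_inverse zero_le)
  then have "coeffs p = map (coeff p) [0..<a] @ ?cs"
    using False by (simp add: coeffs_def degree_eq del: upt_Suc)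
  then have "dropWhile (\<lambda>c. c = 0) (coeffs p) = dropWhile (\<lambda>c. c = 0) ?cs"
    using below by (simp add: dropWhile_append del: upt_Suc)
  also have "\<dots> = ?cs"
    using a_nz \<open>a \<le> d - a\<close> by (simp add: upt_conv_Cons del: upt_Suc)
  finally have drop: "dropWhile (\<lambda>c. c = 0) (coeffs p) = ?cs" .
  have "rev (map abs ?cs) = map abs ?cs"
  proof (rule nth_equalityI)
    fix j assume "j < length (rev (map abs ?cs))"
    then have j: "j < Suc (d - a) - a" by (simp del: upt_Suc)
    then have "a + (Suc (d - a) - a - Suc j) = d - (a + j)"
      by linarith
    then have "rev (map abs ?cs) ! j = \<bar>coeff p (d - (a + j))\<bar>"
      using j by (simp add: rev_nth del: upt_Suc)
    also have "\<dots> = \<bar>coeff p (a + j)\<bar>"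
      using j by (intro sym) linarith
    also have "\<dots> = map abs ?cs ! j"
      using j by (simp del: upt_Suc)
    finally show "rev (map abs ?cs) ! j = map abs ?cs ! j" .
  qed simp
  then show ?thesis
    unfolding palindromic_ignoring_signs_def drop Let_def .
qed

lemma as_many_positive_as_negativeI:
  fixes p :: "int poly"
  assumes deg: "degree p \<le> d"
    and antisym: "\<And>i. i \<le> d \<Longrightarrow> coeff p (d - i) = - coeff p i"
  shows "as_many_positive_as_negative p"
proof -
  have le: "i \<le> d" if "coeff p i \<noteq> 0" for i
    using le_degree[OF that] deg by simp
  have "bij_betw (\<lambda>i. d - i) {i. coeff p i > 0} {i. coeff p i < 0}"
    by (rule bij_betw_byWitness[where f' = "\<lambda>i. d - i"])
      (use le antisym in \<open>force+\<close>)
  then show ?thesis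
    unfolding as_many_positive_as_negative_def by (rule bij_betw_same_card)
qed

text \<open>
  Cutting the coefficient list at \<open>m\<close> separates the signs. As both parts have equally
  many nonzero entries, this cut is the cut in the middle of the list of nonzero coefficients.
\<close>

lemma lower_half_positive_rest_negativeI:
  fixes p :: "int poly"
  assumes balanced: "as_many_positive_as_negative p"
    and low: "\<And>i. i < m \<Longrightarrow> coeff p i \<ge> 0"
    and high: "\<And>i. i \<ge> m \<Longrightarrow> coeff p i \<le> 0"
  shows "lower_half_positive_rest_negative p"
proof -
  let ?cs = "coeffs p"
  define xs where "xs = filter (\<lambda>c. c \<noteq> 0) (take m ?cs)"
  define ys where "ys = filter (\<lambda>c. c \<noteq> 0) (drop m ?cs)"
  have nth: "?cs ! i = coeff p i" if "i < length ?cs" for i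
    using that by (metis nth_default_coeffs_eq nth_default_nth)
  have low': "c \<ge> 0" if "c \<in> set (take m ?cs)" for c
    using that by (auto simp: in_set_conv_nth nth low)
  have high': "c \<le> 0" if "c \<in> set (drop m ?cs)" for c
    using that by (auto simp: in_set_conv_nth nth high)
  have filter_split: "filter P ?cs = filter P (take m ?cs) @ filter P (drop m ?cs)" for P
    by (metis append_take_drop_id filter_append)
  have split: "nonzero_coeffs p = xs @ ys"
    unfolding nonzero_coeffs_def xs_def ys_def by (rule filter_split)
  have "xs = filter (\<lambda>c. c > 0) (take m ?cs)" "filter (\<lambda>c. c > 0) (drop m ?cs) = []"
    unfolding xs_def using low' high'
    by (force intro: filter_cong, force simp: filter_empty_conv)
  then have xs: "xs = filter (\<lambda>c. c > 0) ?cs"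
    by (simp add: filter_split[where P = "\<lambda>c. c > 0"])
  have "ys = filter (\<lambda>c. c < 0) (drop m ?cs)" "filter (\<lambda>c. c < 0) (take m ?cs) = []"
    unfolding ys_def using low' high'
    by (force intro: filter_cong, force simp: filter_empty_conv)
  then have ys: "ys = filter (\<lambda>c. c < 0) ?cs"
    by (simp add: filter_split[where P = "\<lambda>c. c < 0"])
  have card: "length (filter P ?cs) = card {i. P (coeff p i)}" if "\<not> P 0" for P
  proof -
    have "{i. i < length ?cs \<and> P (?cs ! i)} = {i. P (coeff p i)}"
      using that by (auto simp: nth_default_coeffs_eq[symmetric] nth_default_def split: if_splits)
    then show ?thesis by (simp add: length_filter_conv_card)
  qed
  have "length xs = length ys"
    using balanced by (simp add: xs ys card as_many_positive_as_negative_def)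
  then have "length (nonzero_coeffs p) div 2 = length xs"
    by (simp add: split)
  then show ?thesis
    unfolding lower_half_positive_rest_negative_def Let_def
    by (auto simp: split) (auto simp: xs ys)
qed

section \<open>Ballot numbers\<close>

lemma coeff_one_minus_q_times_one_plus_q_power:
  "coeff ((1 - q) * (1 + q) ^ n) i =
    int (n choose i) - (case i of 0 \<Rightarrow> 0 | Suc j \<Rightarrow> int (n choose j))"
proof -
  have "(1 - q) * (1 + q) ^ n = [:1, 1:] ^ n - pCons 0 ([:1, 1:] ^ n)"
    by (simp add: one_pCons algebra_simps)
  moreover have "coeff ([:1, 1:] ^ n) j = int (n choose j)" for j
  proof (cases "j \<le> n")
    case False
    then have "degree ([:1, 1:] ^ n :: int poly) < j"
      by (simp add: degree_linear_power)
    with False show ?thesis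
      by (simp add: coeff_eq_0 binomial_eq_0)
  qed (simp add: coeff_linear_poly_power)
  ultimately show ?thesis
    by (simp add: coeff_pCons split: nat.split)
qed

theorem theorem1p6:
  fixes n :: nat and p :: "int poly"
  assumes "n \<ge> 1"
  defines "p \<equiv> (\<Sum>k = 0..n. (- (q ^ 2)) ^ (n - k) * q_fact k * q_stirling n k) - 1"
  shows "palindromic_ignoring_signs p \<and> as_many_positive_as_negative p \<and>
    lower_half_positive_rest_negative p"
proof -
  have p_eq: "p = (1 - q) * (1 + q) ^ n + monom 1 (Suc n) - 1"
    unfolding p_def atLeast0AtMost alternating_q_stirling_sum monom_altdef by simp
  have coeff_p: "coeff p i =
      (if 1 \<le> i \<and> i \<le> n then int (n choose i) - int (n choose (i - 1)) else 0)" for i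
    unfolding p_eq coeff_add coeff_diff coeff_one_minus_q_times_one_plus_q_power
    by (cases i) (auto simp: not_le binomial_eq_0 less_Suc_eq)
  have deg: "degree p \<le> Suc n"
    by (rule degree_le) (simp add: coeff_p)
  have antisym: "coeff p (Suc n - i) = - coeff p i" if "i \<le> Suc n" for i
  proof (cases "1 \<le> i \<and> i \<le> n")
    case True
    then have "n choose (Suc n - i) = n choose (i - 1)" "n choose (n - i) = n choose i"
      using binomial_symmetric[of "i - 1" n] binomial_symmetric[of i n] by auto
    moreover have "Suc n - i - 1 = n - i"
      by simp
    ultimately show ?thesis
      using True unfolding coeff_p by auto
  next
    case False
    then show ?thesis using that by (auto simp: coeff_p)
  qed
  have low: "coeff p i \<ge> 0" if "2 * i \<le> n" for i
    using binomial_mono[of "i - 1" i n] that by (simp add: coeff_p)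
  have high: "coeff p i \<le> 0" if "2 * i > n" for i
  proof (cases "i \<le> Suc n \<and> 2 * i \<noteq> Suc n")
    case True
    then have "2 * (Suc n - i) \<le> n"
      using that by linarith
    then show ?thesis
      using True low[of "Suc n - i"] antisym[of i] that by simp
  next
    case False
    \<comment> \<open>For odd \<open>n\<close> the middle index is its own mirror image, so its coefficient vanishes.\<close>
    then consider "i > Suc n" | "Suc n - i = i" "i \<le> Suc n"
      by linarith
    then show ?thesis
      using antisym[of i] by cases (auto simp: coeff_p)
  qed
  have "as_many_positive_as_negative p"
    using deg antisym by (rule as_many_positive_as_negativeI)
  moreover have "palindromic_ignoring_signs p"
    using deg by (rule palindromic_ignoring_signsI) (simp add: antisym)
  moreover have "lower_half_positive_rest_negative p"
  proof (rule lower_half_positive_rest_negativeI[where m = "Suc (n div 2)"])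
    show "as_many_positive_as_negative p"
      by fact
  qed (auto intro!: low high)
  ultimately show ?thesis by blast
qed

end
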